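(* Let $0<K<N$ be integers, let $\sigma>0$, let $S\in Sp(2N,\mathbb{R})$ and let $U=U_S$ be the associated $N$-mode Gaussian unitary. Let $\epsilon>0$. Let $P_{\mathrm{succ}}(\epsilon)$ be the decoding success probability (under i.i.d. classical displacement noise of variance $\sigma^2$ and maximum likelihood error decoding) of the oscillator-to-oscillator code encoding $K$ modes into $N$ modes with Gaussian encoding unitary $U$. Then $$P_{\mathrm{succ}}(\epsilon)\leq \mu_Z\left(\mathcal{B}_{\epsilon\cdot \mathsf{sq}(U)/\sigma}(0)\right),$$ where $\mu_Z$ is the probability measure of a standard Gaussian vector $Z\sim\mathcal{N}(0,I_{2K})$ on $\mathbb{R}^{2K}$ and $\mathcal{B}_\delta(0)\subset\mathbb{R}^{2K}$ is the closed Euclidean ball of radius $\delta$ centered at the origin.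
   Context: Symplectic group: $Sp(2N,\mathbb{R})=\{S\in\mathrm{Mat}_{2N\times 2N}(\mathbb{R})\mid S^TJS=J\}$ with $J=\bigoplus_{j=1}^N\begin{pmatrix}0&1\\-1&0\end{pmatrix}$. With mode operators $R=(Q_1,P_1,\dots,Q_N,P_N)$, the Gaussian unitary $U_S$ is characterized by $U_SR_jU_S^\dagger=\sum_k S_{j,k}R_k$. Squeezing measure: writing the Euler decomposition $S=O_1ZO_2$ with $O_1,O_2$ orthogonal symplectic and $Z=\mathrm{diag}(z_1,1/z_1,\dots,z_N,1/z_N)$, $z_j>0$, one sets $\mathsf{sq}(U_S)=\max_j\{z_j,1/z_j\}$; equivalently $\mathsf{sq}(U_S)=\sqrt{\lambda_{\max}(S^TS)}$, where $\lambda_{\max}$ denotes the largest eigenvalue. Oscillator-to-oscillator code: a $K$-mode state $|\Psi\rangle$ is encoded as $U_S(|\Psi\rangle\otimes|\mathsf{GKP}\rangle^{\otimes (N-K)})$, where $|\mathsf{GKP}\rangle$ is the simultaneous $+1$-eigenstate of $e^{i\sqrt{2\pi}Q}$ and $e^{i\sqrt{2\pi}P}$. The physical noise is a random phase space displacement by $\xi\sim\mathcal{N}(0,\sigma^2I_{2N})$, $\xi\in\mathbb{R}^{2N}$. The quantities relevant to the claim are purely classical: - Let $\Pi_A:\mathbb{R}^{2N}\to\mathbb{R}^{2K}$ and $\Pi_B:\mathbb{R}^{2N}\to\mathbb{R}^{2(N-K)}$ be the projections onto the first $2K$ and the last $2(N-K)$ coordinates. - The syndrome of $\xi$ is $s(\xi)=(\Pi_B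 S\xi)\bmod\sqrt{2\pi}\in[-\sqrt{\pi/2},\sqrt{\pi/2})^{2(N-K)}$ (modulo operation applied entrywise). - The maximum likelihood error estimator is $\hat\xi^{\mathsf{ML}}(s)=\mathrm{argmax}_{\xi\in\mathbb{R}^{2N}:\, s(\xi)=s} f(\xi)$, where $f$ is the density of $\mathcal{N}(0,\sigma^2I_{2N})$; ties are broken arbitrarily. - The residual logical displacement is $x_A(\xi)=\Pi_A S\left(\xi-\hat\xi^{\mathsf{ML}}(s(\xi))\right)\in\mathbb{R}^{2K}$. - The decoding success probability is $P_{\mathrm{succ}}(\epsilon)=\Pr_{\xi\sim\mathcal{N}(0,\sigma^2I_{2N})}\left[\|x_A(\xi)\|\leq\epsilon\right]$, with $\|\cdot\|$ the Euclidean norm. *)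

theory Defs
  imports "HOL-Probability.Probability"
begin

text \<open>
  Phase space of a finite set \<open>'n\<close> of modes: the coordinate \<open>(j, False)\<close> is the position \<open>Q\<^sub>j\<close> and
  \<open>(j, True)\<close> is the momentum \<open>P\<^sub>j\<close> of mode \<open>j\<close>. The \<open>K\<close> logical modes are indexed by a finite type
  \<open>'k\<close>, the \<open>N - K\<close> auxiliary modes by a finite type \<open>'m\<close>, and all \<open>N\<close> modes by \<open>'k + 'm\<close>, logical
  modes first; \<open>0 < K < N\<close> holds because types are nonempty.
\<close>

type_synonym 'n phase_space = "real ^ ('n \<times> bool)"
type_synonym 'n phase_matrix = "real ^ ('n \<times> bool) ^ ('n \<times> bool)"

definition symplectic_form :: "'n::finite phase_matrix" where
  "symplectic_form = (\<chi> p q. if fst p = fst q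
     then (if \<not> snd p \<and> snd q then 1 else if snd p \<and> \<not> snd q then - 1 else 0)
     else 0)"

definition symplectic :: "'n::finite phase_matrix \<Rightarrow> bool" where
  "symplectic S \<longleftrightarrow> transpose S ** symplectic_form ** S = symplectic_form"

definition squeezing_matrix :: "('n::finite \<Rightarrow> real) \<Rightarrow> 'n phase_matrix" where
  "squeezing_matrix z = (\<chi> p q. if p = q then (if snd p then 1 / z (fst p) else z (fst p)) else 0)"

definition euler_decomposition ::
  "'n::finite phase_matrix \<Rightarrow> 'n phase_matrix \<Rightarrow> ('n \<Rightarrow> real) \<Rightarrow> 'n phase_matrix \<Rightarrow> bool" where
  "euler_decomposition S O1 z O2 \<longleftrightarrow>
     orthogonal_matrix O1 \<and> symplectic O1 \<and> orthogonal_matrix O2 \<and> symplectic O2 \<and>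
     (\<forall>j. 0 < z j) \<and> S = O1 ** squeezing_matrix z ** O2"

text \<open>
  Every symplectic matrix has an Euler decomposition, and the number below does not depend on the
  choice of the decomposition: it is the largest singular value of \<open>S\<close>.
\<close>

definition sq :: "'n::finite phase_matrix \<Rightarrow> real" where
  "sq S = (THE r. \<exists>O1 z O2. euler_decomposition S O1 z O2 \<and> r = Max (\<Union>j. {z j, 1 / z j}))"

definition proj_A :: "('k::finite + 'm::finite) phase_space \<Rightarrow> 'k phase_space" where
  "proj_A x = (\<chi> p. x $ (Inl (fst p), snd p))"

definition proj_B :: "('k::finite + 'm::finite) phase_space \<Rightarrow> 'm phase_space" where
  "proj_B x = (\<chi> p. x $ (Inr (fst p), snd p))"

text \<open>
  The representative of \<open>x\<close> modulo \<open>sqrt (2 * pi)\<close> in the half-open interval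
  \<open>[- sqrt (pi / 2), sqrt (pi / 2))\<close>; note that \<open>round\<close> rounds half-integers up and that
  \<open>sqrt (pi / 2)\<close> is half of \<open>sqrt (2 * pi)\<close>.
\<close>

definition centered_mod :: "real \<Rightarrow> real" where
  "centered_mod x = x - sqrt (2 * pi) * of_int (round (x / sqrt (2 * pi)))"

definition syndrome :: "('k::finite + 'm::finite) phase_matrix \<Rightarrow> ('k + 'm) phase_space \<Rightarrow> 'm phase_space" where
  "syndrome S \<xi> = (\<chi> p. centered_mod (proj_B (S *v \<xi>) $ p))"

definition gaussian_density :: "real \<Rightarrow> real ^ 'i::finite \<Rightarrow> real" where
  "gaussian_density \<sigma> x = (\<Prod>i\<in>UNIV. normal_density 0 \<sigma> (x $ i))"

definition gaussian_measure :: "real \<Rightarrow> (real ^ 'i::finite) measure" where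
  "gaussian_measure \<sigma> = density lborel (\<lambda>x. ennreal (gaussian_density \<sigma> x))"

text \<open>
  Ties are broken arbitrarily: any choice of maximisers is a maximum likelihood estimator. Its values
  outside the set of syndromes are irrelevant.
\<close>

definition max_likelihood_estimator ::
  "real \<Rightarrow> ('k::finite + 'm::finite) phase_matrix \<Rightarrow> ('m phase_space \<Rightarrow> ('k + 'm) phase_space) \<Rightarrow> bool" where
  "max_likelihood_estimator \<sigma> S est \<longleftrightarrow>
     (\<forall>s \<in> range (syndrome S). is_arg_max (gaussian_density \<sigma>) (\<lambda>\<xi>. syndrome S \<xi> = s) (est s))"

definition residual_displacement ::
  "('k::finite + 'm::finite) phase_matrix \<Rightarrow> ('m phase_space \<Rightarrow> ('k + 'm) phase_space)
     \<Rightarrow> ('k + 'm) phase_space \<Rightarrow> 'k phase_space" where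
  "residual_displacement S est \<xi> = proj_A (S *v (\<xi> - est (syndrome S \<xi>)))"

text \<open>
  The tie-breaking rule need not be Borel measurable, so the probability is taken with respect to the
  completed Gaussian measure. Ties occur only for syndromes in a countable union of hyperplanes,
  hence with probability zero, so the event is measurable for the completion whatever the rule.
\<close>

definition success_probability ::
  "real \<Rightarrow> ('k::finite + 'm::finite) phase_matrix \<Rightarrow> ('m phase_space \<Rightarrow> ('k + 'm) phase_space)
     \<Rightarrow> real \<Rightarrow> real" where
  "success_probability \<sigma> S est \<epsilon> =
     measure (completion (gaussian_measure \<sigma>)) {\<xi>. norm (residual_displacement S est \<xi>) \<le> \<epsilon>}"

end

theory Submission
  imports Defs
begin

text \<open>
  Let \<open>W\<close> be the preimage under \<open>S\<close> of the logical phase space. The syndrome of \<open>\<xi>\<close> depends only on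
  the component of \<open>\<xi>\<close> in the orthogonal complement of \<open>W\<close>. With this component fixed, the residual
  displacement is an affine function of the component \<open>w\<close> in \<open>W\<close>, namely \<open>S (w + w\<^sub>0)\<close> for some \<open>w\<^sub>0\<close>
  in \<open>W\<close>. The Euler decomposition shows that the inverse of \<open>S\<close> has the same operator norm \<open>sq S\<close>
  as \<open>S\<close>, so decoding succeeds only if \<open>w\<close> lies in a ball of radius \<open>\<epsilon> * sq S\<close>, and among such
  balls the centred one has the largest Gaussian measure. Integrating over the complement of \<open>W\<close>
  gives the bound.
\<close>

section \<open>Gaussian measures\<close>

lemma nn_integral_lborel_translate:
  fixes g :: "'a::euclidean_space \<Rightarrow> ennreal"
  assumes [measurable]: "g \<in> borel_measurable borel"
  shows "(\<integral>\<^sup>+x. g (x + c) \<partial>lborel) = (\<integral>\<^sup>+x. g x \<partial>lborel)"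
proof -
  have "(\<integral>\<^sup>+x. g x \<partial>lborel) = (\<integral>\<^sup>+x. g x \<partial>distr lborel borel ((+) c))"
    by (simp add: lborel_distr_plus)
  also have "\<dots> = (\<integral>\<^sup>+x. g (x + c) \<partial>lborel)"
    by (subst nn_integral_distr) (simp_all add: add.commute)
  finally show ?thesis by simp
qed

text \<open>
  Translation invariance and Fubini's theorem show that the two measures are proportional; the unit
  balls have the same volume in both spaces, so the factor is 1.
\<close>

lemma distr_lborel_isometry:
  fixes f :: "'a::euclidean_space \<Rightarrow> 'b::euclidean_space"
  assumes lin: "linear f" and iso: "\<And>x. norm (f x) = norm x" and dim: "DIM('a) = DIM('b)"
  shows "distr lborel borel f = lborel"
proof (rule measure_eqI)
  have f[measurable]: "f \<in> borel_measurable borel"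
    using lin by (intro borel_measurable_continuous_onI linear_continuous_on linear_conv_bounded_linear[THEN iffD1])
  have "inj f"
    unfolding linear_injective_0[OF lin] by (metis iso norm_eq_zero)
  then have "dim (range f) = DIM('b)"
    using lin dim by (simp add: dim_image_eq)
  then have surj: "range f = UNIV"
    using lin by (metis dim_eq_full linear_subspace_image span_eq_iff subspace_UNIV)
  fix A assume "A \<in> sets (distr lborel borel f)"
  then have A[measurable]: "A \<in> sets borel" by simp
  \<comment> \<open>\<open>b\<close> is the test function of a convolution argument: it is even, its
    integral \<open>c\<close> is positive and finite, and \<open>b\<close> composed with the
    isometry \<open>f\<close> is again the indicator of a unit ball.\<close>
  define b :: "'b \<Rightarrow> ennreal" where "b = indicator (cball 0 1)"
  have b[measurable]: "b \<in> borel_measurable borel"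
    unfolding b_def by (intro borel_measurable_indicator) simp
  have b_minus: "b (- y) = b y" for y
    by (simp add: b_def indicator_def)
  define c where "c = emeasure lborel (cball (0::'b) 1)"
  have c: "c \<noteq> 0" "c \<noteq> \<infinity>"
    using unit_ball_vol_pos[of "real DIM('b)", THEN less_imp_neq]
    by (simp_all add: c_def emeasure_cball)
  have int_b: "(\<integral>\<^sup>+y. b y \<partial>lborel) = c"
    by (simp add: b_def c_def)
  have "(\<lambda>t. b (f t)) = indicator (cball 0 1)"
    by (auto simp: b_def indicator_def iso fun_eq_iff)
  then have int_bf: "(\<integral>\<^sup>+t. b (f t) \<partial>lborel) = c"
    by (simp add: c_def emeasure_cball dim)
  have "emeasure (distr lborel borel f) A = (\<integral>\<^sup>+t. indicator A (f t) \<partial>lborel)"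
    by (simp add: nn_integral_distr flip: nn_integral_indicator)
  then have "emeasure (distr lborel borel f) A * c = (\<integral>\<^sup>+t. indicator A (f t) * c \<partial>lborel)"
    by (simp add: nn_integral_multc)
  \<comment> \<open>Translation invariance lets \<open>c\<close> be written as the integral of
    \<open>b\<close> shifted by \<open>f t\<close>, which sets up the exchange of the two
    integrals.\<close>
  also have "\<dots> = (\<integral>\<^sup>+t. (\<integral>\<^sup>+y. indicator A (f t) * b (y + - f t) \<partial>lborel) \<partial>lborel)"
  proof (rule nn_integral_cong)
    fix t
    show "indicator A (f t) * c = (\<integral>\<^sup>+y. indicator A (f t) * b (y + - f t) \<partial>lborel)"
      by (subst nn_integral_cmult, measurable) (simp only: nn_integral_lborel_translate[OF b] int_b)
  qed
  also have "\<dots> = (\<integral>\<^sup>+y. (\<integral>\<^sup>+t. indicator A (f t) * b (y + - f t) \<partial>lborel) \<partial>lborel)"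
    by (rule lborel_pair.Fubini') measurable
  also have "\<dots> = (\<integral>\<^sup>+y. (\<integral>\<^sup>+t. indicator A (f t + y) * b (f t) \<partial>lborel) \<partial>lborel)"
  proof (rule nn_integral_cong)
    fix y
    \<comment> \<open>Surjectivity of \<open>f\<close> makes the shift by \<open>y\<close> a
      translation of \<open>t\<close> in the source; it moves from \<open>b\<close> to the indicator
      of \<open>A\<close>.\<close>
    obtain s where y: "y = f s" using surj by blast
    have "(\<integral>\<^sup>+t. indicator A (f t) * b (y + - f t) \<partial>lborel)
        = (\<integral>\<^sup>+t. indicator A (f (t + s)) * b (y + - f (t + s)) \<partial>lborel)"
      by (rule nn_integral_lborel_translate[symmetric]) measurable
    also have "\<dots> = (\<integral>\<^sup>+t. indicator A (f t + y) * b (f t) \<partial>lborel)"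
      using lin by (simp add: linear_add y b_minus)
    finally show "(\<integral>\<^sup>+t. indicator A (f t) * b (y + - f t) \<partial>lborel)
        = (\<integral>\<^sup>+t. indicator A (f t + y) * b (f t) \<partial>lborel)" .
  qed
  also have "\<dots> = (\<integral>\<^sup>+t. (\<integral>\<^sup>+y. indicator A (f t + y) * b (f t) \<partial>lborel) \<partial>lborel)"
    by (rule lborel_pair.Fubini') measurable
  also have "\<dots> = (\<integral>\<^sup>+t. emeasure lborel A * b (f t) \<partial>lborel)"
  proof (rule nn_integral_cong)
    fix t
    have "(\<integral>\<^sup>+y. indicator A (f t + y) * b (f t) \<partial>lborel)
        = (\<integral>\<^sup>+y. indicator A (y + f t) \<partial>lborel) * b (f t)"
      by (subst nn_integral_multc) (simp_all add: add.commute)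
    also have "(\<integral>\<^sup>+y. indicator A (y + f t) \<partial>lborel) = emeasure lborel A"
      by (subst nn_integral_lborel_translate) simp_all
    finally show "(\<integral>\<^sup>+y. indicator A (f t + y) * b (f t) \<partial>lborel) = emeasure lborel A * b (f t)" .
  qed
  also have "\<dots> = emeasure lborel A * c"
    by (simp add: nn_integral_cmult int_bf)
  finally show "emeasure (distr lborel borel f) A = emeasure lborel A"
    using c by (simp add: mult.commute[of _ c] ennreal_mult_cancel_left)
qed simp

section \<open>The Gaussian density and its mass on balls\<close>

text \<open>Dependence on the norm alone is what allows comparing the density on balls and splitting
  it along orthogonal subspaces.\<close>

lemma gaussian_density_radial:
  fixes x :: "real^'i"
  assumes "0 < \<sigma>"
  shows "gaussian_density \<sigma> x
    = (1 / sqrt (2 * pi * \<sigma>\<^sup>2)) ^ CARD('i) * exp (- (norm x)\<^sup>2 / (2 * \<sigma>\<^sup>2))"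
proof -
  have "(norm x)\<^sup>2 = (\<Sum>i\<in>UNIV. (x $ i)\<^sup>2)"
    unfolding power2_norm_eq_inner inner_vec_def by (simp add: power2_eq_square)
  then have "- (norm x)\<^sup>2 / (2 * \<sigma>\<^sup>2) = (\<Sum>i\<in>UNIV. - (x $ i)\<^sup>2 / (2 * \<sigma>\<^sup>2))"
    by (simp add: sum_negf sum_divide_distrib)
  then show ?thesis
    unfolding gaussian_density_def normal_density_def prod.distrib by (simp add: exp_sum power_divide)
qed

lemma gaussian_density_nonneg: "0 \<le> gaussian_density \<sigma> x"
  by (simp add: gaussian_density_def prod_nonneg)

lemma gaussian_density_measurable[measurable]: "gaussian_density \<sigma> \<in> borel_measurable borel"
  unfolding gaussian_density_def by measurable

lemma sets_gaussian_measure[simp, measurable_cong]: "sets (gaussian_measure \<sigma>) = sets borel"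
  by (simp add: gaussian_measure_def)

lemma space_gaussian_measure[simp]: "space (gaussian_measure \<sigma>) = UNIV"
  by (simp add: gaussian_measure_def)

lemma emeasure_gaussian_measure:
  "A \<in> sets borel \<Longrightarrow> emeasure (gaussian_measure \<sigma>) A
    = (\<integral>\<^sup>+x. ennreal (gaussian_density \<sigma> x) * indicator A x \<partial>lborel)"
  by (simp add: gaussian_measure_def emeasure_density)

lemma prob_space_gaussian_measure:
  assumes "0 < \<sigma>"
  shows "prob_space (gaussian_measure \<sigma> :: (real^'i) measure)"
proof
  have inj: "inj (\<lambda>i::'i. axis i (1::real))"
    by (simp add: inj_on_def axis_eq_axis)
  have Basis: "(Basis :: (real^'i) set) = range (\<lambda>i. axis i 1)"
    by (auto simp: Basis_vec_def)
  have dens: "ennreal (gaussian_density \<sigma> x) = (\<Prod>b\<in>Basis. ennreal (normal_density 0 \<sigma> (x \<bullet> b)))"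
    for x :: "real^'i"
    by (simp add: gaussian_density_def Basis prod.reindex[OF inj] inner_axis prod_ennreal)
  have "(\<integral>\<^sup>+x. ennreal (normal_density 0 \<sigma> x) \<partial>lborel) = 1"
    using prob_space.emeasure_space_1[OF prob_space_normal_density[OF assms, of 0]]
    by (simp add: emeasure_density)
  then have "(\<integral>\<^sup>+x. ennreal (gaussian_density \<sigma> (x :: real^'i)) \<partial>lborel) = 1"
    unfolding dens by (subst nn_integral_lborel_prod) simp_all
  then show "emeasure (gaussian_measure \<sigma>) (space (gaussian_measure \<sigma> :: (real^'i) measure)) = 1"
    by (simp add: emeasure_gaussian_measure)
qed

text \<open>Removing the intersection \<open>E\<close> leaves pieces \<open>D1\<close> and
  \<open>D2\<close> of equal volume. With \<open>g\<close> the density on the sphere of radius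
  \<open>r\<close> about the origin, the density is at most \<open>g\<close> on \<open>D1\<close>,
  outside the centred ball, and at least \<open>g\<close> on \<open>D2\<close>, inside it.\<close>

lemma gaussian_measure_cball_le:
  fixes c :: "real^'i"
  assumes "0 < \<sigma>" "0 \<le> r"
  shows "emeasure (gaussian_measure \<sigma>) (cball c r) \<le> emeasure (gaussian_measure \<sigma>) (cball (0 :: real^'i) r)"
proof -
  let ?G = "gaussian_measure \<sigma> :: (real^'i) measure"
  define g where
    "g = ennreal ((1 / sqrt (2 * pi * \<sigma>\<^sup>2)) ^ CARD('i) * exp (- r\<^sup>2 / (2 * \<sigma>\<^sup>2)))"
  define D1 where "D1 = cball c r - cball 0 r"
  define D2 where "D2 = cball 0 r - cball c r"
  define E where "E = cball c r \<inter> cball 0 r"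
  have [measurable]: "D1 \<in> sets borel" "D2 \<in> sets borel" "E \<in> sets borel"
    by (auto simp: D1_def D2_def E_def)
  have split: "cball c r = D1 \<union> E" "cball 0 r = D2 \<union> E" "D1 \<inter> E = {}" "D2 \<inter> E = {}"
    by (auto simp: D1_def D2_def E_def)
  have "emeasure lborel (cball c r) = emeasure lborel (cball (0::real^'i) r)"
    using assms by (simp add: emeasure_cball)
  then have "emeasure lborel D1 + emeasure lborel E = emeasure lborel D2 + emeasure lborel E"
    using split by (simp add: plus_emeasure)
  \<comment> \<open>Finiteness permits cancelling the common volume in the extended reals.\<close>
  moreover have "emeasure lborel E \<noteq> \<infinity>"
    using emeasure_mono[of E "cball c r" lborel] assms
    by (auto simp: E_def emeasure_cball top_unique)
  ultimately have vol: "emeasure lborel D1 = emeasure lborel D2"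
    by simp
  have "emeasure ?G D1 \<le> (\<integral>\<^sup>+x. g * indicator D1 x \<partial>lborel)"
    unfolding emeasure_gaussian_measure[OF \<open>D1 \<in> sets borel\<close>]
  proof (intro nn_integral_mono)
    fix x
    show "ennreal (gaussian_density \<sigma> x) * indicator D1 x \<le> g * indicator D1 x"
    proof (cases "x \<in> D1")
      case True
      then have "r\<^sup>2 \<le> (norm x)\<^sup>2"
        using assms by (simp add: D1_def power_mono)
      then show ?thesis
        using True assms by (auto simp: g_def gaussian_density_radial divide_right_mono
            intro!: ennreal_leI mult_left_mono)
    qed simp
  qed
  also have "\<dots> = (\<integral>\<^sup>+x. g * indicator D2 x \<partial>lborel)"
    by (simp add: nn_integral_cmult_indicator vol)
  also have "\<dots> \<le> emeasure ?G D2"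
    unfolding emeasure_gaussian_measure[OF \<open>D2 \<in> sets borel\<close>]
  proof (intro nn_integral_mono)
    fix x
    show "g * indicator D2 x \<le> ennreal (gaussian_density \<sigma> x) * indicator D2 x"
    proof (cases "x \<in> D2")
      case True
      then have "(norm x)\<^sup>2 \<le> r\<^sup>2"
        using assms by (simp add: D2_def power_mono)
      then show ?thesis
        using True assms by (auto simp: g_def gaussian_density_radial divide_right_mono
            intro!: ennreal_leI mult_left_mono)
    qed simp
  qed
  finally have "emeasure ?G D1 + emeasure ?G E \<le> emeasure ?G D2 + emeasure ?G E"
    by (rule add_right_mono)
  then have "emeasure ?G (D1 \<union> E) \<le> emeasure ?G (D2 \<union> E)"
    using split by (simp add: plus_emeasure)
  then show ?thesis
    unfolding split(1,2) .
qed

text \<open>Dilation by \<sigma> has a Jacobian that exactly compensates the change of normalisation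
  from variance \<sigma>^2 to variance 1.\<close>

lemma gaussian_measure_cball_scale:
  assumes "0 < \<sigma>"
  shows "emeasure (gaussian_measure \<sigma>) (cball (0 :: real^'i) r)
    = emeasure (gaussian_measure 1) (cball (0 :: real^'i) (r / \<sigma>))"
proof -
  have dens: "\<sigma> ^ CARD('i) * gaussian_density \<sigma> (\<sigma> *\<^sub>R x) = gaussian_density 1 x" for x :: "real^'i"
    using assms
    by (simp add: gaussian_density_radial real_sqrt_mult power_mult_distrib power_divide)
  define h where "h x = ennreal (gaussian_density \<sigma> x) * indicator (cball 0 r) x" for x :: "real^'i"
  have [measurable]: "cball (0 :: real^'i) r \<in> sets borel" by simp
  have [measurable]: "h \<in> borel_measurable borel"
    unfolding h_def by measurable
  have "emeasure (gaussian_measure \<sigma>) (cball (0 :: real^'i) r)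
      = (\<integral>\<^sup>+x. h x \<partial>density (distr lborel borel (\<lambda>x. 0 + \<sigma> *\<^sub>R x)) (\<lambda>_. ennreal (\<bar>\<sigma>\<bar> ^ DIM(real^'i))))"
    unfolding emeasure_gaussian_measure[OF borel_closed[OF closed_cball]] h_def
    by (rule arg_cong[where f = "\<lambda>M. nn_integral M _"], rule lborel_affine) (use assms in simp)
  also have "\<dots> = (\<integral>\<^sup>+x. ennreal (\<sigma> ^ CARD('i)) * h (\<sigma> *\<^sub>R x) \<partial>lborel)"
    using assms by (simp add: nn_integral_density nn_integral_distr)
  also have "\<dots> = (\<integral>\<^sup>+x. ennreal (gaussian_density 1 x) * indicator (cball (0 :: real^'i) (r / \<sigma>)) x \<partial>lborel)"
    using assms
    by (intro nn_integral_cong)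
      (auto simp: h_def indicator_def field_simps ennreal_mult gaussian_density_nonneg simp flip: dens)
  finally show ?thesis
    by (simp add: emeasure_gaussian_measure)
qed

text \<open>The map \<open>h (x, y) = f x + g y\<close> is a linear isometry between spaces of equal
  dimension, so it preserves Lebesgue measure, and the Gaussian density factorises along it. By
  Fubini the measure of \<open>B\<close> is a Gaussian average over \<open>y\<close> of the measures
  of its fibres.\<close>

lemma emeasure_gaussian_measure_le_fibrewise:
  fixes f :: "real^'a \<Rightarrow> real^'n" and g :: "real^'b \<Rightarrow> real^'n"
  assumes \<sigma>: "0 < \<sigma>" and lin: "linear f" "linear g"
    and iso: "\<And>x. norm (f x) = norm x" "\<And>y. norm (g y) = norm y"
    and orth: "\<And>x y. f x \<bullet> g y = 0"
    and card: "CARD('a) + CARD('b) = CARD('n)"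
    and B[measurable]: "B \<in> sets borel"
    and bound: "\<And>y. emeasure (gaussian_measure \<sigma>) {x. f x + g y \<in> B} \<le> C"
  shows "emeasure (gaussian_measure \<sigma>) B \<le> C"
proof -
  define h where "h = (\<lambda>(x, y). f x + g y)"
  have "linear h"
    using lin by (auto simp: h_def linear_iff algebra_simps)
  have norm_h: "(norm (f x + g y))\<^sup>2 = (norm x)\<^sup>2 + (norm y)\<^sup>2" for x y
    using iso orth
    by (simp add: norm_add_Pythagorean orthogonal_def)
  then have "norm (h p) = norm p" for p
    by (cases p) (simp add: h_def norm_Pair flip: norm_h)
  then have distr: "distr lborel borel h = lborel"
    using \<open>linear h\<close> card by (intro distr_lborel_isometry) auto
  have [measurable]: "f \<in> borel_measurable borel" "g \<in> borel_measurable borel"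
      "h \<in> borel_measurable borel"
    using lin \<open>linear h\<close>
    by (auto intro!: borel_measurable_continuous_onI linear_continuous_on simp: linear_conv_bounded_linear)
  \<comment> \<open>Pythagoras splits the exponent, and the cardinality assumption splits the
    normalising power.\<close>
  have dens: "ennreal (gaussian_density \<sigma> (f x + g y))
      = ennreal (gaussian_density \<sigma> y) * ennreal (gaussian_density \<sigma> x)" for x y
    using \<sigma>
    by (simp add: gaussian_density_radial norm_h card[symmetric] power_add add_divide_distrib exp_add
        diff_divide_distrib exp_diff ennreal_mult[symmetric] mult_ac flip: exp_add)
  have "emeasure (gaussian_measure \<sigma>) B
      = (\<integral>\<^sup>+p. ennreal (gaussian_density \<sigma> (h p)) * indicator B (h p) \<partial>lborel)"
    by (simp add: emeasure_gaussian_measure flip: distr) (simp add: nn_integral_distr)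
  also have "\<dots> = (\<integral>\<^sup>+p. ennreal (gaussian_density \<sigma> (h p)) * indicator B (h p) \<partial>(lborel \<Otimes>\<^sub>M lborel))"
    by (simp add: lborel_prod)
  also have "\<dots> = (\<integral>\<^sup>+y. \<integral>\<^sup>+x. ennreal (gaussian_density \<sigma> (h (x, y))) * indicator B (h (x, y)) \<partial>lborel \<partial>lborel)"
    by (subst lborel_pair.nn_integral_snd[symmetric]) (auto simp: lborel_prod)
  also have "\<dots> = (\<integral>\<^sup>+y. ennreal (gaussian_density \<sigma> y) *
      emeasure (gaussian_measure \<sigma>) {x. f x + g y \<in> B} \<partial>lborel)"
  proof (rule nn_integral_cong)
    fix y
    have [measurable]: "{x. f x + g y \<in> B} \<in> sets borel" by measurable
    show "(\<integral>\<^sup>+x. ennreal (gaussian_density \<sigma> (h (x, y))) * indicator B (h (x, y)) \<partial>lborel)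
      = ennreal (gaussian_density \<sigma> y) * emeasure (gaussian_measure \<sigma>) {x. f x + g y \<in> B}"
      by (subst emeasure_gaussian_measure, measurable, subst nn_integral_cmult[symmetric])
        (auto simp: h_def dens indicator_def intro!: nn_integral_cong)
  qed
  also have "\<dots> \<le> (\<integral>\<^sup>+y. ennreal (gaussian_density \<sigma> (y :: real^'b)) * C \<partial>lborel)"
    by (intro nn_integral_mono mult_left_mono bound) simp
  also have "\<dots> = C"
    using prob_space.emeasure_space_1[OF prob_space_gaussian_measure[OF \<sigma>, where 'i='b]]
    by (simp add: nn_integral_multc emeasure_gaussian_measure)
  finally show ?thesis .
qed

section \<open>Euler decomposition\<close>

lemma symplectic_form_mult_vec:
  "(symplectic_form *v x) $ p = (if snd p then - x $ (fst p, False) else x $ (fst p, True))"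
proof -
  have "(symplectic_form *v x) $ p
      = (\<Sum>q\<in>UNIV. if q = (fst p, \<not> snd p) then (if snd p then - 1 else 1) * x $ q else 0)"
    unfolding matrix_vector_mult_def symplectic_form_def
    by (auto intro!: sum.cong simp: prod_eq_iff)
  then show ?thesis
    by simp
qed

lemma sum_modes:
  fixes f :: "'n::finite \<times> bool \<Rightarrow> real"
  shows "sum f UNIV = (\<Sum>j\<in>UNIV. f (j, False) + f (j, True))"
  proof -
  have "sum f UNIV = (\<Sum>j\<in>UNIV. \<Sum>b\<in>UNIV. f (j, b))"
    unfolding sum.cartesian_product by simp
  then show ?thesis by (simp add: UNIV_bool add.commute)
qed

lemma symplectic_form_skew:
  "x \<bullet> (symplectic_form *v y) = - ((symplectic_form *v x) \<bullet> y)"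
  by (simp add: inner_vec_def sum_modes symplectic_form_mult_vec sum_negf[symmetric] algebra_simps)

lemma symplectic_form_twice: "symplectic_form *v (symplectic_form *v x) = - x"
  by (simp add: vec_eq_iff symplectic_form_mult_vec)

lemma inner_symplectic_form_self: "x \<bullet> (symplectic_form *v x) = 0"
  by (simp add: inner_vec_def sum_modes symplectic_form_mult_vec)

lemma inner_symplectic_form_both:
  "(symplectic_form *v x) \<bullet> (symplectic_form *v y) = x \<bullet> y"
  by (simp add: symplectic_form_skew symplectic_form_twice)

lemma symplectic_form_square: "symplectic_form ** symplectic_form = - mat 1"
proof -
  have "(- mat 1) *v x = - x" for x :: "'a phase_space"
    by (simp add: vec_eq_iff matrix_vector_mult_def mat_def sum_negf if_distrib if_distribR
        cong: if_cong)
  then show ?thesis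
    by (simp add: matrix_eq matrix_vector_mul_assoc[symmetric] symplectic_form_twice)
qed

lemma symplectic_mult:
  assumes "symplectic S" "symplectic T"
  shows "symplectic (S ** T)"
proof -
  have "transpose (S ** T) ** symplectic_form ** (S ** T)
      = transpose T ** (transpose S ** symplectic_form ** S) ** T"
    by (simp add: matrix_transpose_mul matrix_mul_assoc)
  then show ?thesis
    using assms by (simp add: symplectic_def)
qed

text \<open>The defining relation makes \<open>- (J S^T J)\<close> a left inverse of
  \<open>S\<close>. In finite dimension it is also a right inverse, and this rearranges to
  \<open>S J S^T = J\<close>.\<close>

lemma symplectic_transpose:
  assumes "symplectic S"
  shows "symplectic (transpose S)"
proof -
  let ?J = "symplectic_form"
  have neg: "A ** (- B) = - (A ** B)" "(- A) ** B = - (A ** B)"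
    for A B :: "'a phase_matrix"
    by (simp_all add: matrix_matrix_mult_def vec_eq_iff sum_negf)
  have "(- (?J ** transpose S ** ?J)) ** S = - (?J ** (transpose S ** ?J ** S))"
    by (simp add: neg matrix_mul_assoc)
  also have "\<dots> = mat 1"
    using assms by (simp add: symplectic_def symplectic_form_square)
  finally have "S ** (- (?J ** transpose S ** ?J)) = mat 1"
    using matrix_left_right_inverse by blast
  then have "S ** ?J ** transpose S ** ?J = - mat 1"
    by (simp add: neg matrix_mul_assoc) (metis minus_minus)
  then have "S ** ?J ** transpose S ** (?J ** ?J) = - ?J"
    by (simp add: matrix_mul_assoc neg)
  then have "S ** ?J ** transpose S = ?J"
    by (simp add: symplectic_form_square neg)
  then show ?thesis
    by (simp add: symplectic_def)
qed

lemma symplectic_invertible: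
  assumes "symplectic S"
  shows "S *v x = 0 \<longleftrightarrow> x = 0"
proof
  assume "S *v x = 0"
  then have "symplectic_form *v x = 0"
    using assms unfolding symplectic_def
    by (metis matrix_vector_mul_assoc matrix_vector_mult_0_right)
  then show "x = 0"
    by (metis symplectic_form_twice matrix_vector_mult_0_right neg_equal_0_iff_equal)
qed simp

section \<open>Eigenvectors of symmetric symplectic matrices\<close>

text \<open>The eigenvector maximises the Rayleigh quotient on the subspace.\<close>

lemma symmetric_eigenvector_in_subspace:
  fixes A :: "real^'a^'a"
  assumes sym: "transpose A = A" and V: "subspace V" "V \<noteq> {0}"
    and inv: "\<And>x. x \<in> V \<Longrightarrow> A *v x \<in> V"
  obtains \<Lambda> v where "v \<in> V" "norm v = 1" "A *v v = \<Lambda> *\<^sub>R v"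
proof -
  have adj: "x \<bullet> (A *v y) = (A *v x) \<bullet> y" for x y
    by (metis sym dot_lmul_matrix vector_transpose_matrix)
  define K where "K = sphere 0 1 \<inter> V"
  have K1: "compact K"
    unfolding K_def using closed_subspace[OF V(1)] by (simp add: compact_Int_closed)
  have K2: "K \<noteq> {}"
  proof -
    obtain x where "x \<in> V" "x \<noteq> 0"
      using V subspace_0 by blast
    then have "x /\<^sub>R norm x \<in> K"
      using V(1) by (simp add: K_def subspace_scale)
    then show ?thesis by blast
  qed
  have K3: "continuous_on K (\<lambda>x. x \<bullet> (A *v x))"
    by (intro continuous_intros matrix_vector_mult_linear_continuous_on)
  obtain v where v: "v \<in> K" and max: "\<And>x. x \<in> K \<Longrightarrow> x \<bullet> (A *v x) \<le> v \<bullet> (A *v v)"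
    using continuous_attains_sup[OF K1 K2 K3] by blast
  define \<Lambda> where "\<Lambda> = v \<bullet> (A *v v)"
  have vV: "v \<in> V" "norm v = 1"
    using v by (auto simp: K_def)
  have bound: "x \<bullet> (A *v x) \<le> \<Lambda> * (x \<bullet> x)" if "x \<in> V" for x
  proof (cases "x = 0")
    case False
    then have "x /\<^sub>R norm x \<in> K"
      using V(1) that by (simp add: K_def subspace_scale)
    from max[OF this] have "(x \<bullet> (A *v x)) / (norm x)^2 \<le> \<Lambda>"
      by (simp add: \<Lambda>_def matrix_vector_mult_scaleR power2_eq_square divide_inverse mult.commute mult.left_commute)
    then show ?thesis
      using False by (simp add: divide_le_eq power2_norm_eq_inner)
  qed simp
  \<comment> \<open>\<open>w\<close> is the defect in the eigenvector equation; invariance keeps it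
    in \<open>V\<close>, so it is an admissible direction of variation.\<close>
  define w where "w = \<Lambda> *\<^sub>R v - A *v v"
  have wV: "w \<in> V"
    unfolding w_def using vV V(1) inv by (simp add: subspace_diff subspace_scale)
  define c where "c = \<Lambda> * (w \<bullet> w) - w \<bullet> (A *v w)"
  \<comment> \<open>The Rayleigh bound along the line \<open>v + t w\<close>: its constant term
    vanishes, so nonnegativity for all \<open>t\<close> forces the linear coefficient to
    vanish.\<close>
  have q: "0 \<le> 2 * t * (w \<bullet> w) + t\<^sup>2 * c" for t
  proof -
    have "v + t *\<^sub>R w \<in> V"
      using vV wV V(1) by (simp add: subspace_add subspace_scale)
    from bound[OF this]
    have "0 \<le> \<Lambda> * ((v + t *\<^sub>R w) \<bullet> (v + t *\<^sub>R w)) - (v + t *\<^sub>R w) \<bullet> (A *v (v + t *\<^sub>R w))"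
      by simp
    also have "\<dots> = \<Lambda> * (v \<bullet> v) - v \<bullet> (A *v v) + 2 * t * (\<Lambda> * (v \<bullet> w) - w \<bullet> (A *v v)) + t\<^sup>2 * c"
      using adj[of v w]
      by (simp add: c_def inner_commute power2_eq_square algebra_simps)
    also have "\<Lambda> * (v \<bullet> w) - w \<bullet> (A *v v) = w \<bullet> w"
      by (simp add: w_def inner_commute algebra_simps)
    also have "\<Lambda> * (v \<bullet> v) - v \<bullet> (A *v v) = 0"
      using vV(2) by (simp add: \<Lambda>_def norm_eq_1)
    finally show ?thesis by simp
  qed
  have "w \<bullet> w = 0"
  proof (rule ccontr)
    assume "w \<bullet> w \<noteq> 0"
    then have pos: "w \<bullet> w > 0"
      by (simp add: less_le)
    \<comment> \<open>A step so small that at \<open>t = - s\<close> the linear term dominates the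
      quadratic one; the added 1 covers \<open>c = 0\<close>.\<close>
    define s where "s = (w \<bullet> w) / (\<bar>c\<bar> + 1)"
    have s: "s > 0" "s * c < 2 * (w \<bullet> w)"
    proof -
      show "s > 0" using pos by (simp add: s_def)
      have "s * c \<le> s * (\<bar>c\<bar> + 1)"
        using \<open>s > 0\<close> by (intro mult_left_mono) auto
      also have "\<dots> = w \<bullet> w" by (simp add: s_def add_eq_0_iff)
      finally show "s * c < 2 * (w \<bullet> w)" using pos by linarith
    qed
    have "s * (s * c) < s * (2 * (w \<bullet> w))"
      using s by (intro mult_strict_left_mono)
    then show False
      using q[of "- s"] by (simp add: power2_eq_square algebra_simps)
  qed
  then have "A *v v = \<Lambda> *\<^sub>R v"
    by (simp add: w_def)
  then show thesis
    using vV that by blast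
qed

text \<open>Since \<open>A J A = J\<close>, the map \<open>J\<close> sends an eigenvector for
  \<open>l\<close> to one for \<open>1 / l\<close>, so eigenvectors come in pairs. Induction over
  the modes picks a unit eigenvector orthogonal to all pairs found so far; \<open>A\<close>
  preserves that complement because it is symmetric.\<close>

lemma symplectic_eigenbasis:
  fixes A :: "'n::finite phase_matrix"
  assumes sym: "transpose A = A" and sp: "symplectic A"
    and pos: "\<And>x. x \<noteq> 0 \<Longrightarrow> 0 < x \<bullet> (A *v x)"
  obtains v :: "'n \<Rightarrow> 'n phase_space" and \<Lambda> :: "'n \<Rightarrow> real"
  where "\<And>j. 0 < \<Lambda> j" "\<And>j. A *v v j = \<Lambda> j *\<^sub>R v j"
    "\<And>j. A *v (symplectic_form *v v j) = (1 / \<Lambda> j) *\<^sub>R (symplectic_form *v v j)"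
    "\<And>j l. v j \<bullet> v l = (if j = l then 1 else 0)" "\<And>j l. v j \<bullet> (symplectic_form *v v l) = 0"
proof -
  let ?J = "symplectic_form :: 'n phase_matrix"
  have adj: "x \<bullet> (A *v y) = (A *v x) \<bullet> y" for x y
    by (metis sym dot_lmul_matrix vector_transpose_matrix)
  have AJ: "A *v (?J *v u) = (1 / l) *\<^sub>R (?J *v u)" if "A *v u = l *\<^sub>R u" "0 < l" for u l
  proof -
    have "A *v (?J *v (A *v u)) = ?J *v u"
      using sp sym by (metis symplectic_def matrix_vector_mul_assoc)
    then have "l *\<^sub>R (A *v (?J *v u)) = ?J *v u"
      by (simp add: that matrix_vector_mult_scaleR)
    then have "(1 / l) *\<^sub>R (l *\<^sub>R (A *v (?J *v u))) = (1 / l) *\<^sub>R (?J *v u)"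
      by simp
    then show ?thesis
      using that(2) by simp
  qed
  define good where "good F v \<Lambda> \<longleftrightarrow> (\<forall>j\<in>F. 0 < \<Lambda> j \<and> A *v v j = \<Lambda> j *\<^sub>R v j \<and>
      (\<forall>l\<in>F. v j \<bullet> v l = (if j = l then 1 else 0) \<and> v j \<bullet> (?J *v v l) = 0))"
    for F and v :: "'n \<Rightarrow> 'n phase_space" and \<Lambda> :: "'n \<Rightarrow> real"
  have "finite F \<Longrightarrow> \<exists>v \<Lambda>. good F v \<Lambda>" for F
  proof (induction F rule: finite_induct)
    case empty
    show ?case unfolding good_def by blast
  next
    case (insert i F)
    then obtain v \<Lambda> where g: "good F v \<Lambda>" by blast
    define T where "T = v ` F \<union> (\<lambda>j. ?J *v v j) ` F"
    define V where "V = {x. \<forall>y\<in>T. y \<bullet> x = 0}"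
    \<comment> \<open>At most \<open>2 * card F\<close> vectors have been used, fewer than the
      dimension, so the complement \<open>V\<close> is nonzero.\<close>
    have "card F < CARD('n)"
      using insert by (metis UNIV_I finite psubsetI psubset_card_mono subset_UNIV)
    have "dim T \<le> card T"
      by (rule dim_le_card') (simp add: T_def)
    also have "\<dots> \<le> card (v ` F) + card ((\<lambda>j. ?J *v v j) ` F)"
      unfolding T_def by (rule card_Un_le)
    also have "\<dots> \<le> card F + card F"
      by (intro add_mono card_image_le) auto
    also have "\<dots> < DIM('n phase_space)"
      using \<open>card F < CARD('n)\<close> by simp
    finally obtain x where "x \<noteq> 0" "\<And>y. y \<in> span T \<Longrightarrow> orthogonal x y"
      using orthogonal_to_subspace_exists by blast
    then have "x \<in> V"
      by (auto simp: V_def orthogonal_def inner_commute span_base)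
    then have V: "subspace V" "V \<noteq> {0}"
      using \<open>x \<noteq> 0\<close> by (auto simp: V_def subspace_def inner_add_right)
    have inv: "A *v x \<in> V" if "x \<in> V" for x
    proof -
      have "x \<bullet> v j = 0" "x \<bullet> (?J *v v j) = 0" "A *v v j = \<Lambda> j *\<^sub>R v j" "0 < \<Lambda> j" if "j \<in> F" for j
        using \<open>x \<in> V\<close> g that by (auto simp: V_def T_def good_def inner_commute)
      then have "(A *v x) \<bullet> v j = 0" "(A *v x) \<bullet> (?J *v v j) = 0" if "j \<in> F" for j
        using that AJ[of "v j" "\<Lambda> j"] by (simp_all flip: adj)
      then show ?thesis
        by (auto simp: V_def T_def inner_commute)
    qed
    obtain \<mu> u where u: "u \<in> V" "norm u = 1" "A *v u = \<mu> *\<^sub>R u"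
      using symmetric_eigenvector_in_subspace[OF sym V inv] by blast
    have uu: "u \<bullet> u = 1" using u(2) by (simp add: norm_eq_1)
    have "0 < u \<bullet> (A *v u)"
      using u(2) by (intro pos) auto
    then have "0 < \<mu>" by (simp add: u(3) uu)
    \<comment> \<open>Orthogonality of \<open>u\<close> to \<open>J v\<close> gives orthogonality of
      \<open>J u\<close> to \<open>v\<close>, because \<open>J\<close> is skew.\<close>
    have vu: "v j \<bullet> u = 0" "u \<bullet> v j = 0" "u \<bullet> (?J *v v j) = 0" "v j \<bullet> (?J *v u) = 0" if "j \<in> F" for j
      using u(1) that by (auto simp: V_def T_def inner_commute symplectic_form_skew[of "v j"])
    have "good (insert i F) (v(i := u)) (\<Lambda>(i := \<mu>))"
      using g \<open>i \<notin> F\<close> uu u(3) vu \<open>0 < \<mu>\<close>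
      unfolding good_def by (auto simp: inner_symplectic_form_self)
    then show ?case by blast
  qed
  from this[OF finite[of UNIV]] obtain v \<Lambda> where g: "good UNIV v \<Lambda>" by blast
  show thesis
  proof (rule that)
    show "0 < \<Lambda> j" "A *v v j = \<Lambda> j *\<^sub>R v j" for j
      using g by (auto simp: good_def)
    then show "A *v (?J *v v j) = (1 / \<Lambda> j) *\<^sub>R (?J *v v j)" for j
      by (rule AJ[rotated])
    show "v j \<bullet> v l = (if j = l then 1 else 0)" "v j \<bullet> (?J *v v l) = 0" for j l
      using g by (auto simp: good_def)
  qed
qed

section \<open>Squeezing matrices and existence of the decomposition\<close>

lemma squeezing_matrix_mult_vec:
  "(squeezing_matrix z *v x) $ p = (if snd p then 1 / z (fst p) else z (fst p)) * x $ p"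
proof -
  have "(squeezing_matrix z *v x) $ p
      = (\<Sum>q\<in>UNIV. if q = p then (if snd p then 1 / z (fst p) else z (fst p)) * x $ q else 0)"
    by (simp only: matrix_vector_mult_def squeezing_matrix_def vec_lambda_beta, rule sum.cong) auto
  then show ?thesis
    by simp
qed

lemma transpose_squeezing_matrix: "transpose (squeezing_matrix z) = squeezing_matrix z"
  by (auto simp: squeezing_matrix_def transpose_def vec_eq_iff)

lemma squeezing_matrix_inverse:
  assumes "\<And>j. 0 < z j"
  shows "squeezing_matrix (\<lambda>j. 1 / z j) ** squeezing_matrix z = mat 1"
    and "squeezing_matrix z ** squeezing_matrix (\<lambda>j. 1 / z j) = mat 1"
  using assms[THEN less_imp_neq]
  by (simp_all add: matrix_eq matrix_vector_mul_assoc[symmetric] vec_eq_iff squeezing_matrix_mult_vec)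

lemma symplectic_squeezing_matrix:
  assumes "\<And>j. 0 < z j"
  shows "symplectic (squeezing_matrix z)"
  unfolding symplectic_def transpose_squeezing_matrix
  using assms[THEN less_imp_neq]
  by (simp add: matrix_eq matrix_vector_mul_assoc[symmetric] vec_eq_iff squeezing_matrix_mult_vec
      symplectic_form_mult_vec)

text \<open>
  If \<open>v\<^sub>j\<close>, \<open>J v\<^sub>j\<close> is an orthonormal eigenbasis of \<open>S\<^sup>T S\<close> with eigenvalues \<open>\<Lambda>\<^sub>j\<close>, \<open>1 / \<Lambda>\<^sub>j\<close>, then the
  rows of \<open>O\<^sub>2\<close> are \<open>v\<^sub>j\<close> and \<open>- J v\<^sub>j\<close>, \<open>z\<^sub>j\<close> is the square root of \<open>\<Lambda>\<^sub>j\<close>, and \<open>O\<^sub>1 = S O\<^sub>2\<^sup>T Z\<^sup>-\<^sup>1\<close>.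
\<close>

lemma euler_decomposition_exists:
  fixes S :: "'n::finite phase_matrix"
  assumes "symplectic S"
  shows "\<exists>O1 z O2. euler_decomposition S O1 z O2"
proof -
  let ?J = "symplectic_form :: 'n phase_matrix"
  let ?A = "transpose S ** S"
  have quad: "x \<bullet> (?A *v y) = (S *v x) \<bullet> (S *v y)" for x y
    by (metis dot_lmul_matrix matrix_vector_mul_assoc vector_transpose_matrix)
  have pos: "0 < x \<bullet> (?A *v x)" if "x \<noteq> 0" for x
  proof -
    have "S *v x \<noteq> 0"
      using that symplectic_invertible[OF assms] by blast
    then show ?thesis
      by (simp only: quad inner_gt_zero_iff) simp
  qed
  have sym: "transpose ?A = ?A"
    by (simp add: matrix_transpose_mul)
  have sp: "symplectic ?A"
    using assms by (intro symplectic_mult symplectic_transpose)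
  obtain v :: "'n \<Rightarrow> 'n phase_space" and \<Lambda> :: "'n \<Rightarrow> real"
    where v: "\<And>j. 0 < \<Lambda> j" "\<And>j. ?A *v v j = \<Lambda> j *\<^sub>R v j"
    "\<And>j. ?A *v (?J *v v j) = (1 / \<Lambda> j) *\<^sub>R (?J *v v j)"
    "\<And>j l. v j \<bullet> v l = (if j = l then 1 else 0)" "\<And>j l. v j \<bullet> (?J *v v l) = 0"
    by (rule symplectic_eigenbasis[OF sym sp pos]) (assumption, rule that)
  have v5: "(?J *v v l) \<bullet> v j = 0" for j l
    using v(5)[of j l] by (simp add: inner_commute)
  have neg: "M *v (- x) = - (M *v x)" for M :: "'n phase_matrix" and x
    by (simp add: linear_neg[OF matrix_vector_mul_linear])
  \<comment> \<open>The minus sign is forced by the convention for \<open>J\<close>: it makes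
    \<open>v j\<close> paired with \<open>J (- J (v j))\<close> equal to 1 rather than -1.\<close>
  define R where "R p = (if snd p then - (?J *v v (fst p)) else v (fst p))" for p
  define O2 :: "'n phase_matrix" where "O2 = (\<chi> p. R p)"
  define z where "z j = sqrt (\<Lambda> j)" for j
  define Z where "Z = squeezing_matrix z"
  define Zi where "Zi = squeezing_matrix (\<lambda>j. 1 / z j)"
  define O1 where "O1 = S ** transpose O2 ** Zi"
  have z: "0 < z j" for j
    using v(1) by (simp add: z_def)
  have Z: "Zi ** Z = mat 1" "Z ** Zi = mat 1"
    unfolding Z_def Zi_def using squeezing_matrix_inverse z by blast+
  \<comment> \<open>Conjugation by \<open>O2\<close> expresses a matrix in the frame
    \<open>R\<close>. It is applied to the identity for orthogonality, to \<open>J\<close> for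
    symplecticity, and to \<open>S^T S\<close> for diagonalisation.\<close>
  have conj: "(O2 ** M ** transpose O2) $ p $ q = R p \<bullet> (M *v R q)" for M p q
    unfolding matrix_mul_assoc[symmetric] matrix_mult_dot O2_def
    by (simp add: row_def column_def matrix_matrix_mult_def matrix_vector_mult_def transpose_def
        inner_vec_def vec_eq_iff)
  have RR: "R p \<bullet> R q = (if p = q then 1 else 0)" for p q
    by (auto simp: R_def v v5 inner_symplectic_form_both prod_eq_iff)
  have "(O2 ** mat 1 ** transpose O2) = mat 1"
    unfolding vec_eq_iff conj matrix_vector_mul_lid RR by (simp add: mat_def)
  then have O2: "orthogonal_matrix O2"
    by (simp add: orthogonal_matrix_def matrix_left_right_inverse)
  have "R p \<bullet> (?J *v R q) = (if fst p = fst q then if \<not> snd p \<and> snd q then 1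
      else if snd p \<and> \<not> snd q then - 1 else 0 else 0)" for p q
    by (auto simp: R_def v v5 inner_symplectic_form_both symplectic_form_twice neg)
  then have "O2 ** ?J ** transpose O2 = ?J"
    unfolding vec_eq_iff conj by (simp add: symplectic_form_def)
  then have "symplectic (transpose O2)"
    by (simp add: symplectic_def)
  then have sO2: "symplectic O2"
    using symplectic_transpose by fastforce
  define d where "d p = (if snd p then 1 / z (fst p) else z (fst p))" for p :: "'n \<times> bool"
  have AR: "?A *v R q = (d q * d q) *\<^sub>R R q" for q
    using v(1)[of "fst q"] by (auto simp: R_def d_def z_def v neg abs_of_pos)
  have Zsq: "(Z ** Z) $ p $ q = (if p = q then d q * d q else 0)" for p q
  proof -
    have Z_nth: "Z $ p $ q = (if p = q then d q else 0)" for p q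
      by (simp add: Z_def squeezing_matrix_def d_def)
    have "(Z ** Z) $ p $ q = (\<Sum>k\<in>UNIV. if k = p then d p * Z $ p $ q else 0)"
      unfolding matrix_matrix_mult_def vec_lambda_beta by (rule sum.cong) (auto simp: Z_nth)
    then show ?thesis
      by (simp add: Z_nth)
  qed
  have ZZ: "O2 ** ?A ** transpose O2 = Z ** Z"
    unfolding vec_eq_iff conj AR Zsq inner_scaleR_right RR by simp
  \<comment> \<open>In the eigenframe \<open>S^T S\<close> becomes \<open>Z ** Z\<close>, which the
    two factors \<open>Zi\<close> cancel.\<close>
  have "transpose O1 ** O1 = Zi ** (O2 ** (transpose S ** S) ** transpose O2) ** Zi"
    by (simp add: O1_def matrix_transpose_mul Zi_def transpose_squeezing_matrix matrix_mul_assoc)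
  also have "\<dots> = (Zi ** Z) ** (Z ** Zi)"
    unfolding ZZ by (simp add: matrix_mul_assoc)
  finally have O1: "orthogonal_matrix O1"
    by (simp add: Z orthogonal_matrix)
  have sO1: "symplectic O1"
    unfolding O1_def Zi_def using assms sO2 z
    by (intro symplectic_mult symplectic_transpose symplectic_squeezing_matrix) auto
  have "O1 ** Z ** O2 = S ** (transpose O2 ** (Zi ** Z) ** O2)"
    by (simp add: O1_def matrix_mul_assoc)
  also have "\<dots> = S"
    using O2 by (simp add: Z orthogonal_matrix)
  finally have "euler_decomposition S O1 z O2"
    using O1 sO1 O2 sO2 z by (simp add: euler_decomposition_def Z_def)
  then show ?thesis by blast
qed

section \<open>Operator norms and the squeezing measure\<close>

lemma squeezing_matrix_norm_le:
  assumes "\<And>j. 0 < z j" and "\<And>j. z j \<le> r" "\<And>j. 1 / z j \<le> r"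
  shows "norm (squeezing_matrix z *v x) \<le> r * norm x"
proof -
  have "0 < r" using assms less_le_trans by blast
  have "norm (squeezing_matrix z *v x) \<le> norm (r *\<^sub>R x)"
  proof (rule norm_le_componentwise_cart)
    fix p
    have "\<bar>if snd p then 1 / z (fst p) else z (fst p)\<bar> \<le> \<bar>r\<bar>"
      using assms(2,3) assms(1)[of "fst p"] \<open>0 < r\<close> by simp
    then have "\<bar>if snd p then 1 / z (fst p) else z (fst p)\<bar> * \<bar>x $ p\<bar> \<le> \<bar>r\<bar> * \<bar>x $ p\<bar>"
      by (rule mult_right_mono) simp
    then show "norm ((squeezing_matrix z *v x) $ p) \<le> norm ((r *\<^sub>R x) $ p)"
      by (simp only: squeezing_matrix_mult_vec vector_scaleR_component real_norm_def abs_mult real_scaleR_def)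
  qed
  then show ?thesis using \<open>0 < r\<close> by simp
qed

lemma norm_orthogonal_matrix_mult_vec:
  fixes Q :: "real^'a^'a"
  shows "orthogonal_matrix Q \<Longrightarrow> norm (Q *v x) = norm x"
  using orthogonal_transformation_matrix[of "(*v) Q"] orthogonal_transformation_norm by auto

text \<open>Orthogonal factors preserve norms, so only the diagonal factor matters. Its inverse has
  the same diagonal entries in exchanged order, hence the same bound \<open>r\<close> for the
  inverse of \<open>S\<close>. Attainment shows that \<open>r\<close> is determined by
  \<open>S\<close> alone.\<close>

lemma euler_decomposition_bounds:
  assumes "euler_decomposition S O1 z O2"
  defines "r \<equiv> Max (\<Union>j. {z j, 1 / z j})"
  shows "norm (S *v x) \<le> r * norm x" "norm x \<le> r * norm (S *v x)" "\<exists>x. norm x = 1 \<and> norm (S *v x) = r"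
proof -
  from assms(1) have O: "orthogonal_matrix O1" "orthogonal_matrix O2" and z: "\<And>j. 0 < z j"
    and S: "S = O1 ** squeezing_matrix z ** O2"
    by (auto simp: euler_decomposition_def)
  have fin: "finite (\<Union>j. {z j, 1 / z j})" by simp
  then have le: "z j \<le> r" "1 / z j \<le> r" for j
    unfolding r_def by (auto intro!: Max_ge)
  have nS: "norm (S *v y) = norm (squeezing_matrix z *v (O2 *v y))" for y
    by (simp add: S O norm_orthogonal_matrix_mult_vec matrix_vector_mul_assoc[symmetric])
  show "norm (S *v x) \<le> r * norm x"
    using squeezing_matrix_norm_le[OF z le, where x = "O2 *v x"] O
    by (simp add: nS norm_orthogonal_matrix_mult_vec)
  have "squeezing_matrix (\<lambda>j. 1 / z j) *v (squeezing_matrix z *v y) = y" for y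
    using squeezing_matrix_inverse(1)[of z] z by (simp only: matrix_vector_mul_assoc) simp
  then have "norm x = norm (squeezing_matrix (\<lambda>j. 1 / z j) *v (squeezing_matrix z *v (O2 *v x)))"
    using O by (simp only: norm_orthogonal_matrix_mult_vec)
  also have "\<dots> \<le> r * norm (squeezing_matrix z *v (O2 *v x))"
    using le z by (intro squeezing_matrix_norm_le) auto
  finally show "norm x \<le> r * norm (S *v x)" by (simp add: nS)
  have "r \<in> (\<Union>j. {z j, 1 / z j})"
    unfolding r_def using fin by (intro Max_in) auto
  \<comment> \<open>\<open>b\<close> selects the momentum or the position axis of mode
    \<open>j\<close>, according to which diagonal entry equals \<open>r\<close>.\<close>
  then obtain j b where "r = (if b then 1 / z j else z j)"
    by (metis (no_types, lifting) UN_E insert_iff singletonD)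
  then have "squeezing_matrix z *v axis (j, b) 1 = r *\<^sub>R axis (j, b) 1"
    by (auto simp: vec_eq_iff squeezing_matrix_mult_vec axis_def)
  moreover have "0 < r" using z[of undefined] le(1)[of undefined] by simp
  moreover define y where "y = transpose O2 *v axis (j, b) 1"
  moreover have "O2 *v y = axis (j, b) 1"
    unfolding y_def matrix_vector_mul_assoc using O(2) by (simp add: orthogonal_matrix_def)
  ultimately have "norm y = 1 \<and> norm (S *v y) = r"
    using norm_orthogonal_matrix_mult_vec[OF O(2), of y] by (simp add: nS)
  then show "\<exists>x. norm x = 1 \<and> norm (S *v x) = r" by blast
qed

text \<open>The description in \<open>sq\<close> is well defined: the number from any decomposition
  is an attained bound for \<open>S\<close> on unit vectors, so any two such numbers bound each
  other.\<close>

lemma norm_le_sq: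
  assumes "symplectic S"
  shows "0 < sq S" "norm x \<le> sq S * norm (S *v x)"
proof -
  obtain O1 z O2 where e: "euler_decomposition S O1 z O2"
    using euler_decomposition_exists[OF assms] by blast
  have "sq S = Max (\<Union>j. {z j, 1 / z j})"
    unfolding sq_def
  proof (rule the_equality)
    show "\<exists>O1 z' O2. euler_decomposition S O1 z' O2 \<and>
        Max (\<Union>j. {z j, 1 / z j}) = Max (\<Union>j. {z' j, 1 / z' j})"
      using e by blast
  next
    fix r assume "\<exists>O1 z O2. euler_decomposition S O1 z O2 \<and> r = Max (\<Union>j. {z j, 1 / z j})"
    then obtain O1' z' O2' where e': "euler_decomposition S O1' z' O2'"
      and r: "r = Max (\<Union>j. {z' j, 1 / z' j})" by blast
    show "r = Max (\<Union>j. {z j, 1 / z j})"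
      using euler_decomposition_bounds(1,3)[OF e] euler_decomposition_bounds(1,3)[OF e'] r
      by (metis dual_order.antisym mult.right_neutral)
  qed
  then show "norm x \<le> sq S * norm (S *v x)" for x
    using euler_decomposition_bounds(2)[OF e] by simp
  \<comment> \<open>At a unit vector the bound excludes a nonpositive \<open>sq S\<close>.\<close>
  from this[of "axis undefined 1"] show "0 < sq S"
    by (smt (verit) norm_axis_1 norm_ge_zero mult_nonpos_nonneg)
qed

section \<open>Decoding\<close>

text \<open>Padding by zero gives a right inverse of \<open>proj_A\<close> whose range is the kernel
  of \<open>proj_B\<close>; composed with the inverse of \<open>S\<close> it parametrises
  \<open>W\<close>.\<close>

definition embed_A :: "'k::finite phase_space \<Rightarrow> ('k + 'm::finite) phase_space" where
  "embed_A a = (\<chi> p. case fst p of Inl k \<Rightarrow> a $ (k, snd p) | Inr _ \<Rightarrow> 0)"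

lemma linear_embed_A: "linear embed_A"
  by (auto simp: linear_iff embed_A_def vec_eq_iff split: sum.splits)

lemma proj_embed_A [simp]: "proj_A (embed_A a) = a" "proj_B (embed_A a) = 0"
  by (simp_all add: proj_A_def proj_B_def embed_A_def vec_eq_iff)

lemma linear_proj_A: "linear proj_A"
  by (simp add: linear_iff proj_A_def vec_eq_iff)

lemma linear_proj_B: "linear proj_B"
  by (simp add: linear_iff proj_B_def vec_eq_iff)

lemma embed_A_proj_A:
  fixes y :: "('k::finite + 'm::finite) phase_space"
  assumes "proj_B y = 0"
  shows "embed_A (proj_A y) = y"
proof (rule vec_eq_iff[THEN iffD2], rule allI)
  fix p :: "('k + 'm) \<times> bool"
  have "y $ (Inr m, b) = 0" for m b
    using arg_cong[OF assms, of "\<lambda>x. x $ (m, b)"] by (simp add: proj_B_def)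
  then show "embed_A (proj_A y) $ p = y $ p"
    by (cases p) (auto simp: embed_A_def proj_A_def split: sum.split)
qed

lemma sum_UNIV_sum_type:
  fixes f :: "'a::finite + 'b::finite \<Rightarrow> 'c::comm_monoid_add"
  shows "sum f UNIV = (\<Sum>a\<in>UNIV. f (Inl a)) + (\<Sum>b\<in>UNIV. f (Inr b))"
  unfolding UNIV_Plus_UNIV[symmetric] by (subst sum.Plus) simp_all

lemma norm_proj_A:
  assumes "proj_B y = 0"
  shows "norm (proj_A y) = norm y"
proof -
  have "y \<bullet> y = proj_A y \<bullet> proj_A y + proj_B y \<bullet> proj_B y"
    by (simp add: inner_vec_def sum_modes proj_A_def proj_B_def sum_UNIV_sum_type)
  then show ?thesis
    by (simp add: assms norm_eq_sqrt_inner)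
qed

text \<open>A set that is not measurable for the completion has measure 0 by convention.\<close>

lemma measure_completion_le:
  assumes "\<And>B. B \<in> sets M \<Longrightarrow> B \<subseteq> A \<Longrightarrow> emeasure M B \<le> ennreal c" and "0 \<le> c"
  shows "measure (completion M) A \<le> c"
proof (cases "A \<in> sets (completion M)")
  case True
  \<comment> \<open>The main part is a measurable subset of \<open>A\<close> carrying its whole
    completed measure, so bounding measurable subsets suffices.\<close>
  then have "emeasure (completion M) A \<le> ennreal c"
    using assms(1)[OF main_part_sets[OF True]] main_part_null_part_Un[OF True]
    by (metis Un_upper1 emeasure_completion)
  then show ?thesis
    using assms(2) by (simp add: measure_def enn2real_leI)
next
  case False
  then show ?thesis
    using assms(2) by (simp add: measure_notin_sets)
qed

section \<open>Bounding the success probability fibre by fibre\<close>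

theorem theorem3p1:
  fixes S :: "('k::finite + 'm::finite) phase_matrix"
    and est :: "'m phase_space \<Rightarrow> ('k + 'm) phase_space"
    and \<sigma> \<epsilon> :: real
  assumes "0 < \<sigma>" and "0 < \<epsilon>"
    and "symplectic S"
    and "max_likelihood_estimator \<sigma> S est"
  shows "success_probability \<sigma> S est \<epsilon>
    \<le> measure (gaussian_measure 1) (cball (0 :: 'k phase_space) (\<epsilon> * sq S / \<sigma>))"
proof -
  let ?G = "gaussian_measure 1 :: 'k phase_space measure"
  interpret G: prob_space ?G
    by (rule prob_space_gaussian_measure) simp
  have "inj ((*v) S)"
    by (simp add: linear_injective_0 symplectic_invertible[OF assms(3)])
  then obtain T where "T ** S = mat 1"
    using matrix_left_invertible_injective by blast
  then have S_inv: "S ** T = mat 1"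
    by (simp add: matrix_left_right_inverse)
  define e :: "'k phase_space \<Rightarrow> ('k + 'm) phase_space" where "e a = T *v embed_A a" for a
  have S_e: "S *v e a = embed_A a" for a
    by (simp add: e_def matrix_vector_mul_assoc S_inv)
  have lin_S: "linear (\<lambda>x. proj_A (S *v x))" "linear (\<lambda>x. proj_B (S *v x))"
    by (auto simp: linear_iff matrix_vector_right_distrib matrix_vector_mult_scaleR
        linear_add[OF linear_proj_A] linear_add[OF linear_proj_B]
        linear_cmul[OF linear_proj_A] linear_cmul[OF linear_proj_B])
  have "linear e"
    by (auto simp: e_def linear_iff matrix_vector_right_distrib matrix_vector_mult_scaleR
        linear_add[OF linear_embed_A] linear_cmul[OF linear_embed_A])
  have "inj e"
    by (rule inj_on_inverseI[where g = "\<lambda>x. proj_A (S *v x)"]) (simp add: S_e)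
  define W where "W = {x. proj_B (S *v x) = 0}"
  have W: "W = range e"
  proof
    show "W \<subseteq> range e"
    proof
      fix x assume "x \<in> W"
      then have "S *v x = S *v e (proj_A (S *v x))"
        by (simp add: S_e W_def embed_A_proj_A)
      then show "x \<in> range e"
        using \<open>inj ((*v) S)\<close> by (metis injD rangeI)
    qed
  qed (auto simp: W_def S_e)
  have "subspace W"
    unfolding W using \<open>linear e\<close> by (simp add: linear_subspace_image)
  have dim_W: "dim W = DIM('k phase_space)"
    unfolding W using \<open>linear e\<close> \<open>inj e\<close> by (simp add: dim_image_eq)
  define V where "V = {y \<in> UNIV. \<forall>x\<in>W. orthogonal x y}"
  have "subspace V"
    by (auto simp: V_def subspace_def orthogonal_clauses)
  have "dim V + dim W = DIM(('k + 'm) phase_space)"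
    unfolding V_def using dim_subspace_orthogonal_to_vectors[OF \<open>subspace W\<close> subspace_UNIV] by simp
  then have dim_V: "dim V = DIM('m phase_space)"
    by (simp add: dim_W)
  \<comment> \<open>The parametrisation \<open>e\<close> of \<open>W\<close> may distort lengths,
    whereas the Gaussian splitting needs isometric coordinates; equal dimensions provide them on
    \<open>W\<close> and on its complement \<open>V\<close>.\<close>
  obtain f :: "'k phase_space \<Rightarrow> ('k + 'm) phase_space"
    where f: "linear f" "f ` UNIV = W" "\<And>x. norm (f x) = norm x"
    using isometries_subspaces[OF subspace_UNIV \<open>subspace W\<close>] dim_W by (metis UNIV_I dim_UNIV)
  obtain g :: "'m phase_space \<Rightarrow> ('k + 'm) phase_space"
    where g: "linear g" "g ` UNIV = V" "\<And>x. norm (g x) = norm x"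
    using isometries_subspaces[OF subspace_UNIV \<open>subspace V\<close>] dim_V by (metis UNIV_I dim_UNIV)
  have fW: "proj_B (S *v f x) = 0" for x
    using f(2) by (auto simp: W_def)
  have fibre: "\<exists>c. {x. norm (residual_displacement S est (f x + g y)) \<le> \<epsilon>} \<subseteq> cball c (\<epsilon> * sq S)" for y
  proof -
    have syn: "syndrome S (f x + g y) = syndrome S (g y)" for x
      by (simp add: syndrome_def linear_add[OF lin_S(2)] fW)
    \<comment> \<open>\<open>c\<close> is the residual displacement at \<open>x = 0\<close>. Since
      \<open>e c\<close> lies in \<open>W\<close> and is mapped by \<open>S\<close> to the padded
      \<open>c\<close>, this offset can be absorbed as a shift \<open>x0\<close> of
      \<open>x\<close>.\<close>
    define c where "c = proj_A (S *v (g y - est (syndrome S (g y))))"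
    obtain x0 where x0: "f x0 = e c"
      using f(2) W by (metis rangeE rangeI)
    have res: "residual_displacement S est (f x + g y) = proj_A (S *v f (x + x0))" for x
    proof -
      have "residual_displacement S est (f x + g y)
          = proj_A (S *v (f x + (g y - est (syndrome S (g y)))))"
        by (simp add: residual_displacement_def syn algebra_simps)
      also have "\<dots> = proj_A (S *v f (x + x0))"
        by (simp only: linear_add[OF lin_S(1)] linear_add[OF f(1)] x0 S_e proj_embed_A c_def)
      finally show ?thesis .
    qed
    \<comment> \<open>Both \<open>f\<close> and \<open>proj_A\<close> on the kernel of
      \<open>proj_B\<close> preserve norms, so only the inverse of \<open>S\<close> costs a factor
      \<open>sq S\<close>.\<close>
    have "norm (x + x0) \<le> sq S * norm (residual_displacement S est (f x + g y))" for x
      using norm_le_sq(2)[OF assms(3), of "f (x + x0)"] by (simp add: res norm_proj_A fW f(3))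
    then have "norm (x + x0) \<le> \<epsilon> * sq S"
      if "norm (residual_displacement S est (f x + g y)) \<le> \<epsilon>" for x
      using mult_left_mono[OF that, of "sq S"] norm_le_sq(1)[OF assms(3)]
      by (metis less_imp_le mult.commute order_trans)
    then have "{x. norm (residual_displacement S est (f x + g y)) \<le> \<epsilon>} \<subseteq> cball (- x0) (\<epsilon> * sq S)"
      by (auto simp: dist_norm norm_minus_commute[of "- x0"])
    then show ?thesis by blast
  qed
  \<comment> \<open>The success event itself need not be Borel, so the fibre argument is run on its
    Borel subsets.\<close>
  have "emeasure (gaussian_measure \<sigma>) B \<le> emeasure ?G (cball 0 (\<epsilon> * sq S / \<sigma>))"
    if B: "B \<in> sets borel" "B \<subseteq> {\<xi>. norm (residual_displacement S est \<xi>) \<le> \<epsilon>}" for B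
  proof (rule emeasure_gaussian_measure_le_fibrewise[OF assms(1) f(1) g(1) f(3) g(3) _ _ B(1)])
    show "f x \<bullet> g y = 0" for x y
      using f(2) g(2) by (auto simp: V_def orthogonal_def)
    show "CARD('k \<times> bool) + CARD('m \<times> bool) = CARD(('k + 'm) \<times> bool)"
      by simp
    fix y
    obtain c where c: "{x. norm (residual_displacement S est (f x + g y)) \<le> \<epsilon>} \<subseteq> cball c (\<epsilon> * sq S)"
      using fibre by blast
    have "emeasure (gaussian_measure \<sigma>) {x. f x + g y \<in> B}
        \<le> emeasure (gaussian_measure \<sigma>) (cball c (\<epsilon> * sq S))"
      using c B(2) by (intro emeasure_mono) auto
    also have "\<dots> \<le> emeasure (gaussian_measure \<sigma>) (cball (0 :: 'k phase_space) (\<epsilon> * sq S))"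
      using assms(1,2) norm_le_sq(1)[OF assms(3)] by (intro gaussian_measure_cball_le) auto
    also have "\<dots> = emeasure ?G (cball 0 (\<epsilon> * sq S / \<sigma>))"
      by (rule gaussian_measure_cball_scale[OF assms(1)])
    finally show "emeasure (gaussian_measure \<sigma>) {x. f x + g y \<in> B}
        \<le> emeasure ?G (cball 0 (\<epsilon> * sq S / \<sigma>))" .
  qed
  then show ?thesis
    unfolding success_probability_def
    by (intro measure_completion_le) (auto simp: G.emeasure_eq_measure)
qed

end
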